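(* For every integer $n \geq 3$, the enhanced power graph $\mathcal{P}_e(D_{2n})$ of the dihedral group $D_{2n}$ is perfect.
   Context: For $n \geq 3$, $D_{2n} = \langle a, b : a^{n} = b^2 = e,\ ab = ba^{-1} \rangle$ is the dihedral group of order $2n$. The enhanced power graph $\mathcal{P}_e(G)$ of a group $G$ is the simple undirected graph with vertex set $G$ in which two distinct vertices are adjacent if and only if they belong to a common cyclic subgroup of $G$. A graph $\Gamma$ is perfect if for every induced subgraph $\Gamma'$ of $\Gamma$ the clique number $\omega(\Gamma')$ equals the chromatic number $\chi(\Gamma')$. *)

theory Defs
  imports "HOL-Algebra.Elementary_Groups" "Graph_Theory.Digraph_Component"
begin

section \<open>Groups given by generators and relations\<close>

text \<open>A letter \<open>(x, False)\<close> stands for the generator \<open>x\<close> and \<open>(x, True)\<close> for its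
  formal inverse. Relations are pairs of words, to be read as equations.\<close>

type_synonym 'x word = "('x \<times> bool) list"

inductive pres_eq :: "('x word \<times> 'x word) set \<Rightarrow> 'x word \<Rightarrow> 'x word \<Rightarrow> bool"
  for R where
    refl: "pres_eq R u u"
  | sym: "pres_eq R u v \<Longrightarrow> pres_eq R v u"
  | trans: "pres_eq R u v \<Longrightarrow> pres_eq R v w \<Longrightarrow> pres_eq R u w"
  | cancel: "pres_eq R (u @ [(x, e), (x, \<not> e)] @ v) (u @ v)"
  | rel: "(l, r) \<in> R \<Longrightarrow> pres_eq R (u @ l @ v) (u @ r @ v)"

definition pres_class :: "('x word \<times> 'x word) set \<Rightarrow> 'x word \<Rightarrow> 'x word set" where
  "pres_class R u = {v. pres_eq R u v}"

definition presented_group :: "('x word \<times> 'x word) set \<Rightarrow> 'x word set monoid" where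
  "presented_group R =
     \<lparr> carrier = range (pres_class R),
       monoid.mult = (\<lambda>X Y. \<Union>u\<in>X. \<Union>v\<in>Y. pres_class R (u @ v)),
       one = pres_class R [] \<rparr>"

datatype dihedral_gen = Rot | Ref

definition dihedral_rels :: "nat \<Rightarrow> (dihedral_gen word \<times> dihedral_gen word) set" where
  "dihedral_rels n =
     (let a = (Rot, False); a' = (Rot, True); b = (Ref, False) in
       {(replicate n a, []), ([b, b], []), ([a, b], [b, a'])})"

text \<open>\<open>dihedral_group n\<close> has order \<open>2 * n\<close>, see \<open>order_dihedral_group\<close> below.\<close>

definition dihedral_group :: "nat \<Rightarrow> dihedral_gen word set monoid" where
  "dihedral_group n = presented_group (dihedral_rels n)"


section \<open>The enhanced power graph\<close>

text \<open>Undirected graphs are symmetric digraphs, as in \<^theory>\<open>Graph_Theory.Digraph\<close>.\<close>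

definition enhanced_power_graph :: "('a, 'b) monoid_scheme \<Rightarrow> 'a pair_pre_digraph" where
  "enhanced_power_graph G =
     \<lparr> pverts = carrier G,
       parcs = {(x, y). x \<noteq> y \<and>
         (\<exists>C. subgroup C G \<and> cyclic_group (G\<lparr>carrier := C\<rparr>) \<and> x \<in> C \<and> y \<in> C)} \<rparr>"


section \<open>Perfect graphs\<close>

definition is_clique :: "('a, 'b) pre_digraph \<Rightarrow> 'a set \<Rightarrow> bool" where
  "is_clique \<Gamma> K \<longleftrightarrow> K \<subseteq> verts \<Gamma> \<and> (\<forall>u\<in>K. \<forall>v\<in>K. u \<noteq> v \<longrightarrow> u \<rightarrow>\<^bsub>\<Gamma>\<^esub> v)"

definition proper_colouring :: "('a, 'b) pre_digraph \<Rightarrow> nat \<Rightarrow> ('a \<Rightarrow> nat) \<Rightarrow> bool" where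
  "proper_colouring \<Gamma> k f \<longleftrightarrow>
     f ` verts \<Gamma> \<subseteq> {..<k} \<and> (\<forall>u v. u \<rightarrow>\<^bsub>\<Gamma>\<^esub> v \<longrightarrow> f u \<noteq> f v)"

text \<open>These two numbers are meaningful for finite loop-free graphs only.\<close>

definition clique_number :: "('a, 'b) pre_digraph \<Rightarrow> nat" where
  "clique_number \<Gamma> = Max {card K |K. is_clique \<Gamma> K}"

definition chromatic_number :: "('a, 'b) pre_digraph \<Rightarrow> nat" where
  "chromatic_number \<Gamma> = (LEAST k. \<exists>f. proper_colouring \<Gamma> k f)"

definition perfect_graph :: "('a, 'b) pre_digraph \<Rightarrow> bool" where
  "perfect_graph \<Gamma> \<longleftrightarrow>
     (\<forall>\<Gamma>'. induced_subgraph \<Gamma>' \<Gamma> \<longrightarrow> clique_number \<Gamma>' = chromatic_number \<Gamma>')"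


section \<open>Well-definedness\<close>

lemma pres_eq_ctxt: "pres_eq R u v \<Longrightarrow> pres_eq R (p @ u @ q) (p @ v @ q)"
proof (induction rule: pres_eq.induct)
  case (cancel u x e v)
  show ?case using pres_eq.cancel[of R "p @ u" x e "v @ q"] by simp
next
  case (rel l r u v)
  then show ?case using pres_eq.rel[of l r R "p @ u" "v @ q"] by simp
qed (blast intro: pres_eq.refl pres_eq.sym pres_eq.trans)+

lemma pres_eq_append:
  assumes "pres_eq R u u'" "pres_eq R v v'"
  shows "pres_eq R (u @ v) (u' @ v')"
proof (rule pres_eq.trans)
  show "pres_eq R (u @ v) (u' @ v)" using pres_eq_ctxt[OF assms(1), of "[]" v] by simp
  show "pres_eq R (u' @ v) (u' @ v')" using pres_eq_ctxt[OF assms(2), of u' "[]"] by simp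
qed

lemma pres_class_eq_iff: "pres_class R u = pres_class R v \<longleftrightarrow> pres_eq R u v"
proof
  assume "pres_class R u = pres_class R v"
  then have "v \<in> pres_class R u" using pres_eq.refl[of R v] by (simp add: pres_class_def)
  then show "pres_eq R u v" by (simp add: pres_class_def)
next
  assume "pres_eq R u v"
  then have "pres_eq R u w \<longleftrightarrow> pres_eq R v w" for w
    by (meson pres_eq.sym pres_eq.trans)
  then show "pres_class R u = pres_class R v" by (simp add: pres_class_def)
qed

lemma pres_class_mult:
  "pres_class R u \<otimes>\<^bsub>presented_group R\<^esub> pres_class R v = pres_class R (u @ v)"
proof -
  have "pres_class R (u' @ v') = pres_class R (u @ v)"
    if *: "u' \<in> pres_class R u" "v' \<in> pres_class R v" for u' v'
  proof -
    have "pres_eq R (u @ v) (u' @ v')"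
      using * unfolding pres_class_def mem_Collect_eq by (rule pres_eq_append)
    then show ?thesis unfolding pres_class_eq_iff by (rule pres_eq.sym)
  qed
  moreover have "u \<in> pres_class R u" "v \<in> pres_class R v"
    by (simp_all add: pres_class_def pres_eq.refl)
  ultimately have "(\<Union>u'\<in>pres_class R u. \<Union>v'\<in>pres_class R v. pres_class R (u' @ v'))
      = pres_class R (u @ v)"
    by blast
  then show ?thesis
    unfolding presented_group_def monoid.simps .
qed

lemma pres_eq_left_inverse:
  "pres_eq R (rev (map (\<lambda>(x, e). (x, \<not> e)) u) @ u) []"
proof (induction u)
  case (Cons l u)
  obtain x e where l: "l = (x, e)" by (cases l)
  let ?i = "rev (map (\<lambda>(x, e). (x, \<not> e)) u)"
  have "pres_eq R (?i @ [(x, \<not> e), (x, \<not> \<not> e)] @ u) (?i @ u)"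
    by (rule pres_eq.cancel)
  then have "pres_eq R (rev (map (\<lambda>(x, e). (x, \<not> e)) (l # u)) @ l # u) (?i @ u)"
    by (simp add: l)
  from this Cons.IH show ?case by (rule pres_eq.trans)
qed (simp add: pres_eq.refl)

lemma group_presented_group: "group (presented_group R)"
proof (rule groupI)
  fix X assume "X \<in> carrier (presented_group R)"
  then obtain u where X: "X = pres_class R u"
    by (auto simp: presented_group_def)
  let ?Y = "pres_class R (rev (map (\<lambda>(x, e). (x, \<not> e)) u))"
  have "?Y \<in> carrier (presented_group R)"
    by (simp add: presented_group_def)
  moreover have "?Y \<otimes>\<^bsub>presented_group R\<^esub> X = \<one>\<^bsub>presented_group R\<^esub>"
    unfolding X pres_class_mult
    using pres_eq_left_inverse[of R u] by (simp add: presented_group_def pres_class_eq_iff)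
  ultimately show "\<exists>Y\<in>carrier (presented_group R). Y \<otimes>\<^bsub>presented_group R\<^esub> X = \<one>\<^bsub>presented_group R\<^esub>"
    by blast
next
  have carr: "carrier (presented_group R) = range (pres_class R)"
    and one: "\<one>\<^bsub>presented_group R\<^esub> = pres_class R []"
    by (simp_all add: presented_group_def)
  fix X Y assume XY: "X \<in> carrier (presented_group R)" "Y \<in> carrier (presented_group R)"
  then obtain u v where uv: "X = pres_class R u" "Y = pres_class R v"
    by (auto simp: carr)
  show "X \<otimes>\<^bsub>presented_group R\<^esub> Y \<in> carrier (presented_group R)"
    unfolding uv pres_class_mult carr by simp
  fix Z assume "Z \<in> carrier (presented_group R)"
  then obtain w where w: "Z = pres_class R w"
    by (auto simp: carr)
  show "X \<otimes>\<^bsub>presented_group R\<^esub> Y \<otimes>\<^bsub>presented_group R\<^esub> Z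
      = X \<otimes>\<^bsub>presented_group R\<^esub> (Y \<otimes>\<^bsub>presented_group R\<^esub> Z)"
    unfolding uv w pres_class_mult by simp
next
  show "\<one>\<^bsub>presented_group R\<^esub> \<in> carrier (presented_group R)"
    by (simp add: presented_group_def)
next
  fix X assume "X \<in> carrier (presented_group R)"
  then obtain u where u: "X = pres_class R u"
    by (auto simp: presented_group_def)
  have "\<one>\<^bsub>presented_group R\<^esub> = pres_class R []"
    by (simp add: presented_group_def)
  then show "\<one>\<^bsub>presented_group R\<^esub> \<otimes>\<^bsub>presented_group R\<^esub> X = X"
    by (simp add: u pres_class_mult)
qed

lemma group_dihedral_group: "group (dihedral_group n)"
  unfolding dihedral_group_def by (rule group_presented_group)

lemma pair_graph_enhanced_power_graph:
  assumes "group G" "finite (carrier G)"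
  shows "pair_graph (enhanced_power_graph G)"
proof -
  let ?P = "enhanced_power_graph G"
  have V: "pverts ?P = carrier G" by (simp add: enhanced_power_graph_def)
  have "\<And>e. e \<in> parcs ?P \<Longrightarrow> fst e \<in> carrier G \<and> snd e \<in> carrier G \<and> fst e \<noteq> snd e"
    by (auto simp: enhanced_power_graph_def dest: subgroup.mem_carrier)
  moreover from this have "parcs ?P \<subseteq> carrier G \<times> carrier G"
    by (auto simp: mem_Times_iff)
  then have "finite (parcs ?P)"
    using assms(2) by (meson finite_SigmaI finite_subset)
  moreover have "sym (parcs ?P)"
    by (auto simp: enhanced_power_graph_def sym_def)
  ultimately show ?thesis
    using assms(2) by unfold_locales (auto simp: V symmetric_def)
qed

text \<open>The dihedral group acts on the integers modulo \<open>n\<close> by \<open>x \<mapsto> x + 1\<close> and \<open>x \<mapsto> - x\<close>;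
  this action separates the words \<open>a\<^sup>i b\<^sup>j\<close> with \<open>i < n\<close> and \<open>j < 2\<close>.\<close>

fun dihedral_act :: "dihedral_gen word \<Rightarrow> int \<Rightarrow> int" where
  "dihedral_act [] x = x"
| "dihedral_act ((Rot, e) # w) x = dihedral_act w x + (if e then - 1 else 1)"
| "dihedral_act ((Ref, e) # w) x = - dihedral_act w x"

lemma dihedral_act_append: "dihedral_act (u @ v) x = dihedral_act u (dihedral_act v x)"
  by (induction u x rule: dihedral_act.induct) auto

lemma dihedral_act_replicate: "dihedral_act (replicate k (Rot, False)) x = x + int k"
  by (induction k) auto

lemma dihedral_act_dvd:
  "m dvd x - y \<Longrightarrow> m dvd dihedral_act u x - dihedral_act u y"
proof (induction u x rule: dihedral_act.induct)
  case (3 e w x)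
  then show ?case by (simp add: dvd_diff_commute)
qed auto

lemma pres_eq_dihedral_act:
  "pres_eq (dihedral_rels n) u v \<Longrightarrow> int n dvd dihedral_act u x - dihedral_act v x"
proof (induction arbitrary: x rule: pres_eq.induct)
  case (sym u v)
  then show ?case by (metis dvd_diff_commute)
next
  case (trans u v w)
  from dvd_add[OF trans.IH(1)[of x] trans.IH(2)[of x]] show ?case by simp
next
  case (cancel u g e v)
  have "dihedral_act [(g, e), (g, \<not> e)] y = y" for y
    by (cases g) auto
  then show ?case by (simp only: dihedral_act_append diff_self dvd_0_right)
next
  case (rel l r u v)
  have "int n dvd dihedral_act l y - dihedral_act r y" for y
    using rel by (auto simp: dihedral_rels_def Let_def dihedral_act_replicate)
  then show ?case by (simp add: dihedral_act_append dihedral_act_dvd)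
qed simp

definition dihedral_nf :: "nat \<times> nat \<Rightarrow> dihedral_gen word" where
  "dihedral_nf = (\<lambda>(i, j). replicate i (Rot, False) @ replicate j (Ref, False))"

lemma dihedral_word_nf:
  assumes "n > 0"
  shows "\<exists>i j. i < n \<and> j < 2 \<and> pres_eq (dihedral_rels n) u (dihedral_nf (i, j))"
proof -
  define a where "a = (Rot, False)"
  define a' where "a' = (Rot, True)"
  define b where "b = (Ref, False)"
  define b' where "b' = (Ref, True)"
  note defs = a_def a'_def b_def b'_def
  define E where "E = pres_eq (dihedral_rels n)"
  note [trans] = pres_eq.trans[of "dihedral_rels n", folded E_def]
  have refl: "E v v" for v unfolding E_def by (rule pres_eq.refl)
  have sym: "E v w \<Longrightarrow> E w v" for v w unfolding E_def by (rule pres_eq.sym)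
  have ctxt: "E v w \<Longrightarrow> E (p @ v @ q) (p @ w @ q)" for v w p q
    unfolding E_def by (rule pres_eq_ctxt)
  have an: "E (replicate n a) []" and bb: "E [b, b] []" and ab: "E [a, b] [b, a']"
    using pres_eq.rel[of _ _ "dihedral_rels n" "[]" "[]"]
    by (auto simp: E_def dihedral_rels_def Let_def defs)
  have a'a: "E [a', a] []" and aa': "E [a, a'] []" and b'b: "E [b', b] []"
    using pres_eq.cancel[of "dihedral_rels n" "[]" Rot True "[]"]
      pres_eq.cancel[of "dihedral_rels n" "[]" Rot False "[]"]
      pres_eq.cancel[of "dihedral_rels n" "[]" Ref True "[]"]
    by (auto simp: E_def defs)
  have ba: "E [b, a] [a', b]"
  proof -
    have "E [b, a] [a', a, b, a]" using sym[OF ctxt[OF a'a, of "[]" "[b, a]"]] by simp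
    also have "E [a', a, b, a] [a', b, a', a]" using ctxt[OF ab, of "[a']" "[a]"] by simp
    also have "E [a', b, a', a] [a', b]" using ctxt[OF a'a, of "[a', b]" "[]"] by simp
    finally show ?thesis .
  qed
  have bpow: "E (b # replicate i a) (replicate i a' @ [b])" for i
  proof (induction i)
    case (Suc i)
    have "E (b # replicate (Suc i) a) (a' # b # replicate i a)"
      using ctxt[OF ba, of "[]" "replicate i a"] by simp
    also have "E (a' # b # replicate i a) (a' # replicate i a' @ [b])"
      using ctxt[OF Suc.IH, of "[a']" "[]"] by simp
    finally show ?case by simp
  qed (simp add: refl)
  have a'red: "E [a'] (replicate (n - 1) a)"
  proof -
    have "E [a'] (a' # replicate n a)" using sym[OF ctxt[OF an, of "[a']" "[]"]] by simp
    also have "a' # replicate n a = [a', a] @ replicate (n - 1) a"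
      using assms by (cases n) auto
    also have "E \<dots> (replicate (n - 1) a)"
      using ctxt[OF a'a, of "[]" "replicate (n - 1) a"] by simp
    finally show ?thesis .
  qed
  have a'pow: "\<exists>k. E (replicate i a') (replicate k a)" for i
  proof (induction i)
    case 0
    show ?case by (rule exI[of _ 0]) (simp add: refl)
  next
    case (Suc i)
    then obtain k where "E (replicate i a') (replicate k a)" by blast
    then have "E (replicate (Suc i) a') (a' # replicate k a)"
      using ctxt[of "replicate i a'" "replicate k a" "[a']" "[]"] by simp
    also have "E (a' # replicate k a) (replicate (n - 1) a @ replicate k a)"
      using ctxt[OF a'red, of "[]" "replicate k a"] by simp
    finally have "E (replicate (Suc i) a') (replicate (n - 1 + k) a)"
      by (simp only: replicate_add)
    then show ?case by blast
  qed
  have apow: "\<exists>k<n. E (replicate i a) (replicate k a)" for i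
  proof (induction i rule: less_induct)
    case (less i)
    show ?case
    proof (cases "i < n")
      case True
      then show ?thesis using refl by blast
    next
      case False
      then have "E (replicate i a) (replicate (i - n) a)"
        using ctxt[OF an, of "[]" "replicate (i - n) a"] replicate_add[of n "i - n" a] by simp
      moreover obtain k where "k < n" "E (replicate (i - n) a) (replicate k a)"
        using less.IH[of "i - n"] False assms by auto
      ultimately show ?thesis unfolding E_def by (blast intro: pres_eq.trans)
    qed
  qed
  have bpow2: "\<exists>k<2. E (replicate j b) (replicate k b)" for j
  proof (induction j rule: less_induct)
    case (less j)
    show ?case
    proof (cases "j < 2")
      case True
      then show ?thesis using refl by blast
    next
      case False
      then obtain j' where j: "j = Suc (Suc j')"
        using that[of "j - 2"] by simp
      then have "E (replicate j b) (replicate j' b)"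
        using ctxt[OF bb, of "[]" "replicate j' b"] by simp
      moreover obtain k where "k < 2" "E (replicate j' b) (replicate k b)"
        using less.IH[of j'] j by auto
      ultimately show ?thesis unfolding E_def by (blast intro: pres_eq.trans)
    qed
  qed
  have reduce: "\<exists>i j. i < n \<and> j < 2 \<and> E u (replicate i a @ replicate j b)"
    if u: "E u (replicate i a @ replicate j b)" for u i j
  proof -
    obtain k l where k: "k < n" "E (replicate i a) (replicate k a)"
      and l: "l < 2" "E (replicate j b) (replicate l b)" using apow[of i] bpow2[of j] by blast
    note u
    also have "E (replicate i a @ replicate j b) (replicate k a @ replicate l b)"
      using pres_eq_append[OF k(2)[unfolded E_def] l(2)[unfolded E_def]] unfolding E_def .
    finally show ?thesis using k l by blast
  qed
  have b'red: "E [b'] [b]"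
  proof -
    have "E [b'] [b', b, b]" using sym[OF ctxt[OF bb, of "[b']" "[]"]] by simp
    also have "E [b', b, b] [b]" using ctxt[OF b'b, of "[]" "[b]"] by simp
    finally show ?thesis .
  qed
  have bstep: "\<exists>i' j'. E (b # replicate i a @ replicate j b) (replicate i' a @ replicate j' b)"
    for i j
  proof -
    obtain k where k: "E (replicate i a') (replicate k a)" using a'pow by blast
    have "E (b # replicate i a @ replicate j b) (replicate i a' @ [b] @ replicate j b)"
      using ctxt[OF bpow, of "[]" i "replicate j b"] by simp
    also have "E (replicate i a' @ [b] @ replicate j b) (replicate k a @ [b] @ replicate j b)"
      using ctxt[OF k, of "[]" "[b] @ replicate j b"] by simp
    finally have "E (b # replicate i a @ replicate j b) (replicate k a @ replicate (Suc j) b)"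
      by simp
    then show ?thesis by blast
  qed
  have "\<exists>i j. E u (replicate i a @ replicate j b)"
  proof (induction u)
    case Nil
    show ?case by (rule exI[of _ 0], rule exI[of _ 0]) (simp add: refl)
  next
    case (Cons c u)
    then obtain i j where u: "E u (replicate i a @ replicate j b)" by blast
    let ?w = "replicate i a @ replicate j b"
    have step: "E (c # u) (c # ?w)" using ctxt[OF u, of "[c]" "[]"] by simp
    obtain g e where c: "c = (g, e)" by (cases c)
    consider "c = a" | "c = a'" | "c = b" | "c = b'"
      by (cases g; cases e) (auto simp: c defs)
    then show ?case
    proof cases
      case 1
      then have "E (c # u) (replicate (Suc i) a @ replicate j b)" using step by simp
      then show ?thesis by blast
    next
      case 2
      note step
      also have "E (c # ?w) (replicate (n - 1) a @ ?w)"
        using ctxt[OF a'red, of "[]" ?w] 2 by simp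
      finally have "E (c # u) (replicate (n - 1 + i) a @ replicate j b)"
        by (simp add: replicate_add)
      then show ?thesis by blast
    next
      case 3
      obtain i' j' where "E (b # ?w) (replicate i' a @ replicate j' b)" using bstep by blast
      with step show ?thesis using 3 unfolding E_def by (blast intro: pres_eq.trans)
    next
      case 4
      obtain i' j' where "E (b # ?w) (replicate i' a @ replicate j' b)" using bstep by blast
      moreover have "E (c # ?w) (b # ?w)" using ctxt[OF b'red, of "[]" ?w] 4 by simp
      ultimately show ?thesis using step unfolding E_def by (blast intro: pres_eq.trans)
    qed
  qed
  then obtain i j where "E u (replicate i a @ replicate j b)" by blast
  from reduce[OF this] show ?thesis
    unfolding dihedral_nf_def E_def a_def b_def by simp
qed

lemma order_dihedral_group:
  assumes "n \<ge> 3"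
  shows "order (dihedral_group n) = 2 * n"
proof -
  let ?c = "\<lambda>p. pres_class (dihedral_rels n) (dihedral_nf p)"
  have carr: "carrier (dihedral_group n) = range (pres_class (dihedral_rels n))"
    by (simp add: dihedral_group_def presented_group_def)
  have "inj_on ?c ({..<n} \<times> {..<2})"
  proof (rule inj_onI)
    fix p p' assume pp: "p \<in> {..<n} \<times> {..<2::nat}" "p' \<in> {..<n} \<times> {..<2::nat}"
      and eq: "?c p = ?c p'"
    obtain i j i' j' where p: "p = (i, j)" "p' = (i', j')" by fastforce
    have ij: "i < n" "j < 2" "i' < n" "j' < 2" using pp p by auto
    have act: "dihedral_act (dihedral_nf (k, l)) x = int k + (if l = 0 then x else - x)"
      if "l < 2" for k l x
      using that
      by (auto simp: less_2_cases_iff dihedral_nf_def dihedral_act_append dihedral_act_replicate)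
    have d: "int n dvd dihedral_act (dihedral_nf (i, j)) x - dihedral_act (dihedral_nf (i', j')) x" for x
      using eq pres_eq_dihedral_act unfolding p pres_class_eq_iff by blast
    have "int n dvd int i - int i'" using d[of 0] ij by (simp add: act split: if_splits)
    then have "int i mod int n = int i' mod int n" by (simp add: mod_eq_dvd_iff)
    with ij have i: "i = i'" by simp
    have n2: "\<not> int n dvd 2" using assms by (auto dest: zdvd_imp_le)
    have n2': "\<not> int n dvd - 2" using n2 by (simp only: dvd_minus_iff) simp
    have "(j = 0) = (j' = 0)"
    proof (rule ccontr)
      assume "(j = 0) \<noteq> (j' = 0)"
      then have "int n dvd 2 \<or> int n dvd - 2"
        using d[of 1] ij by (cases "j = 0") (simp_all add: act i)
      with n2 n2' show False by blast
    qed
    with i ij show "p = p'" by (auto simp: p less_2_cases_iff)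
  qed
  moreover have "range (pres_class (dihedral_rels n)) = ?c ` ({..<n} \<times> {..<2})"
  proof
    show "range (pres_class (dihedral_rels n)) \<subseteq> ?c ` ({..<n} \<times> {..<2})"
    proof clarify
      fix u
      obtain i j where "i < n" "j < 2" "pres_eq (dihedral_rels n) u (dihedral_nf (i, j))"
        using dihedral_word_nf[of n u] assms by auto
      then show "pres_class (dihedral_rels n) u \<in> ?c ` ({..<n} \<times> {..<2})"
        by (intro image_eqI[of _ _ "(i, j)"]) (auto simp: pres_class_eq_iff)
    qed
  qed auto
  ultimately show ?thesis
    by (simp add: order_def carr card_image)
qed

end

theory Submission
  imports Defs
begin

text \<open>Outside the powers of \<open>a\<close> every element of the dihedral group is an involution. So a cyclic
  subgroup either consists of powers of \<open>a\<close> or has at most two elements, and the enhanced power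
  graph is the clique of the powers of \<open>a\<close> together with pendant vertices attached to the
  identity. In an induced subgraph the powers of \<open>a\<close> get distinct colours and the pendant vertices
  reuse a colour that the identity does not have; if there is none to reuse, then a pendant vertex,
  with the identity if present, is a largest clique and one further colour suffices.\<close>

text \<open>A proper colouring is injective on every clique, so no clique is larger than the number
  of colours. A clique and a colouring of equal size therefore certify each other as
  optimal.\<close>

lemma clique_number_eq_chromatic_number:
  assumes K: "is_clique \<Gamma> K"
    and f: "proper_colouring \<Gamma> (card K) f"
  shows "clique_number \<Gamma> = chromatic_number \<Gamma>"
proof -
  have bound: "card L \<le> k" if L: "is_clique \<Gamma> L" and g: "proper_colouring \<Gamma> k g" for L k g
  proof -
    have "inj_on g L"
    proof (rule inj_onI)
      fix u v assume "u \<in> L" "v \<in> L" "g u = g v"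
      then show "u = v" using L g unfolding is_clique_def proper_colouring_def by metis
    qed
    moreover have "g ` L \<subseteq> {..<k}" using L g unfolding is_clique_def proper_colouring_def by blast
    ultimately show ?thesis using card_inj_on_le[of g L "{..<k}"] by simp
  qed
  have "clique_number \<Gamma> = card K"
    unfolding clique_number_def
  proof (rule Max_eqI)
    have "{card L |L. is_clique \<Gamma> L} \<subseteq> {..card K}" using bound[OF _ f] by blast
    then show "finite {card L |L. is_clique \<Gamma> L}" by (rule finite_subset) simp
  qed (use K bound[OF _ f] in blast)+
  moreover have "chromatic_number \<Gamma> = card K"
    unfolding chromatic_number_def by (rule Least_equality) (use f bound[OF K] in blast)+
  ultimately show ?thesis by simp
qed

text \<open>Neither \<open>e\<close> nor the rest of \<open>A\<close> has to lie in
  \<open>verts \<Gamma>\<close>, so the statement covers every induced subgraph at once, including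
  those that miss the centre \<open>e\<close>.\<close>

lemma clique_number_eq_chromatic_number_pendants:
  assumes fin: "finite (verts \<Gamma>)" and e: "e \<in> A"
    and adj: "\<And>u v. u \<rightarrow>\<^bsub>\<Gamma>\<^esub> v \<longleftrightarrow> u \<in> verts \<Gamma> \<and> v \<in> verts \<Gamma> \<and> u \<noteq> v
      \<and> (u \<in> A \<and> v \<in> A \<or> u = e \<or> v = e)"
  shows "clique_number \<Gamma> = chromatic_number \<Gamma>"
proof -
  define V where "V = verts \<Gamma>"
  \<comment> \<open>\<open>c\<close> serves both as the number of colours taken by \<open>e\<close>
    and as the colour of all vertices outside \<open>A\<close>: the least colour that
    \<open>e\<close>, if present, leaves free.\<close>
  define c :: nat where "c = (if e \<in> V then 1 else 0)"
  define m where "m = card (A \<inter> V)"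
  have finA: "finite (A \<inter> V)" using fin by (simp add: V_def)
  obtain h where h: "bij_betw h (A \<inter> V - {e}) {0..<card (A \<inter> V - {e})}"
    using ex_bij_betw_finite_nat[of "A \<inter> V - {e}"] finA by blast
  \<comment> \<open>Shifting by \<open>c\<close> keeps colour 0 for \<open>e\<close> when
    \<open>e\<close> is present, and wastes no colour when it is absent.\<close>
  define g where "g = (\<lambda>v. if v = e then 0 else h v + c)"
  have m: "m = card (A \<inter> V - {e}) + c"
    using e finA card_Suc_Diff1[of "A \<inter> V" e] by (auto simp: m_def c_def)
  have "g v < m" if "v \<in> A \<inter> V" for v
    using that h by (fastforce simp: g_def m c_def bij_betw_def)
  moreover have "inj_on g (A \<inter> V)"
    using h by (fastforce simp: g_def c_def bij_betw_def inj_on_def)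
  moreover have "g e = 0" by (simp add: g_def)
  ultimately have g: "inj_on g (A \<inter> V)" "g ` (A \<inter> V) \<subseteq> {..<m}" "g e = 0" by auto
  define f where "f = (\<lambda>v. if v \<in> A then g v else c)"
  \<comment> \<open>Colour \<open>c\<close> may also occur on \<open>A - {e}\<close>. This is
    harmless, since a vertex outside \<open>A\<close> has no neighbour but \<open>e\<close>.\<close>
  have proper: "proper_colouring \<Gamma> k f" if "m \<le> k" "V \<subseteq> A \<or> c < k" for k
    unfolding proper_colouring_def V_def[symmetric] adj
  proof (intro conjI allI impI)
    show "f ` V \<subseteq> {..<k}" using g(2) that by (fastforce simp: f_def)
    fix u v
    assume "u \<in> V \<and> v \<in> V \<and> u \<noteq> v \<and> (u \<in> A \<and> v \<in> A \<or> u = e \<or> v = e)"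
    then show "f u \<noteq> f v" using g(1,3) e by (auto simp: f_def c_def inj_on_def)
  qed
  show ?thesis
  proof (cases "V \<subseteq> A \<or> c < m")
    case True
    have "is_clique \<Gamma> (A \<inter> V)" by (auto simp: is_clique_def adj V_def)
    then show ?thesis
      using clique_number_eq_chromatic_number[of \<Gamma> "A \<inter> V"] proper[of m] True by (simp add: m_def)
  next
    \<comment> \<open>Here \<open>m \<le> c\<close>, so \<open>A \<inter> V\<close> contains at most
      \<open>e\<close>, and \<open>Suc c\<close> colours match the clique formed by \<open>s\<close>
      and, if present, \<open>e\<close>.\<close>
    case False
    then obtain s where s: "s \<in> V" "s \<notin> A" by blast
    define K where "K = insert s ({e} \<inter> V)"
    have "card K = Suc c" using s e by (cases "s = e") (auto simp: K_def c_def)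
    moreover have "is_clique \<Gamma> K" using s by (auto simp: K_def is_clique_def adj V_def)
    ultimately show ?thesis
      using clique_number_eq_chromatic_number[of \<Gamma> K] proper[of "Suc c"] False by simp
  qed
qed

text \<open>The type of a cyclic subgroup is decided by its generator \<open>x\<close>: if
  \<open>x\<close> is a power of \<open>a\<close>, so are all its powers; otherwise \<open>x\<close>
  squares to \<open>\<one>\<close> and the subgroup lies in \<open>{\<one>, x}\<close>.\<close>

lemma (in group) enhanced_power_graph_adj:
  assumes a: "a \<in> carrier G"
    and invol: "\<And>x. x \<in> carrier G \<Longrightarrow> x \<notin> range (\<lambda>k::int. a [^] k) \<Longrightarrow> x \<otimes> x = \<one>"
  shows "(u, v) \<in> parcs (enhanced_power_graph G) \<longleftrightarrow> u \<in> carrier G \<and> v \<in> carrier G \<and> u \<noteq> v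
    \<and> (u \<in> range (\<lambda>k::int. a [^] k) \<and> v \<in> range (\<lambda>k::int. a [^] k) \<or> u = \<one> \<or> v = \<one>)"
    (is "_ \<longleftrightarrow> ?R")
proof
  have cyc: "subgroup (range (\<lambda>k::int. x [^] k)) G
      \<and> cyclic_group (G\<lparr>carrier := range (\<lambda>k::int. x [^] k)\<rparr>)" if "x \<in> carrier G" for x
  proof -
    have eq: "carrier (subgroup_generated G {x}) = range (\<lambda>k::int. x [^] k)"
      using that by (rule carrier_subgroup_generated_by_singleton)
    moreover have "subgroup_generated G {x} = G\<lparr>carrier := carrier (subgroup_generated G {x})\<rparr>"
      by (simp add: subgroup_generated_def)
    ultimately show ?thesis
      using subgroup_subgroup_generated[of "{x}"] cyclic_group_generated[of x] by simp
  qed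
  have one: "\<one> \<in> range (\<lambda>k::int. x [^] k)" for x
    by (rule range_eqI[of _ _ 0]) simp
  have self: "x \<in> range (\<lambda>k::int. x [^] k)" if "x \<in> carrier G" for x
    using that by (intro range_eqI[of _ _ 1]) (simp add: int_pow_1)
  \<comment> \<open>The witness is the subgroup generated by \<open>a\<close> for two powers of
    \<open>a\<close>, and the one generated by the other endpoint for an edge at
    \<open>\<one>\<close>.\<close>
  assume ?R
  then show "(u, v) \<in> parcs (enhanced_power_graph G)"
    using cyc[OF a] cyc[of u] cyc[of v] one self
    unfolding enhanced_power_graph_def by auto
next
  assume "(u, v) \<in> parcs (enhanced_power_graph G)"
  then obtain C where neq: "u \<noteq> v" and C: "subgroup C G" "cyclic_group (G\<lparr>carrier := C\<rparr>)"
    and uv: "u \<in> C" "v \<in> C"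
    by (auto simp: enhanced_power_graph_def)
  have CG: "C \<subseteq> carrier G" using C(1) by (rule subgroup.subset)
  obtain x where x: "x \<in> C" and gen: "C = range (\<lambda>k::int. x [^] k)"
  proof -
    obtain x where x: "x \<in> C" and "C = range (\<lambda>k::int. x [^]\<^bsub>G\<lparr>carrier := C\<rparr>\<^esub> k)"
      using C(2) group.cyclic_group[OF subgroup.subgroup_is_group[OF C(1) is_group]]
      unfolding partial_object.simps(1) partial_object.update_convs by auto
    \<comment> \<open>Powers taken inside the subgroup agree with powers taken in
      \<open>G\<close>.\<close>
    then show thesis using that[OF x] by (simp only: int_pow_consistent[OF C(1) x])
  qed
  have xG: "x \<in> carrier G" using x CG by blast
  have "u \<in> range (\<lambda>k::int. a [^] k) \<and> v \<in> range (\<lambda>k::int. a [^] k) \<or> u = \<one> \<or> v = \<one>"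
  proof (cases "x \<in> range (\<lambda>k::int. a [^] k)")
    case True
    then have "C \<subseteq> range (\<lambda>k::int. a [^] k)" using a by (auto simp: gen int_pow_pow)
    with uv show ?thesis by blast
  next
    case False
    then have xx: "x \<otimes> x = \<one>" using invol xG by blast
    have "x [^] k \<in> {\<one>, x}" for k :: int
    proof -
      have "x [^] (2::int) = \<one>" using xx xG int_pow_mult[of x 1 1] by (simp add: int_pow_1)
      then have "x [^] (2 * (k div 2)) = \<one>" using xG by (simp flip: int_pow_pow)
      then have "x [^] k = x [^] (k mod 2)"
        using int_pow_mult[OF xG, of "2 * (k div 2)" "k mod 2"] xG by simp
      moreover have "k mod 2 = 0 \<or> k mod 2 = 1" by auto
      ultimately show ?thesis using xG by (auto simp: int_pow_1)
    qed
    then have "C \<subseteq> {\<one>, x}" by (auto simp: gen)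
    with uv neq show ?thesis by blast
  qed
  with uv CG neq show ?R by blast
qed

lemma (in group) perfect_enhanced_power_graph:
  assumes fin: "finite (carrier G)" and a: "a \<in> carrier G"
    and invol: "\<And>x. x \<in> carrier G \<Longrightarrow> x \<notin> range (\<lambda>k::int. a [^] k) \<Longrightarrow> x \<otimes> x = \<one>"
  shows "perfect_graph (with_proj (enhanced_power_graph G))"
  unfolding perfect_graph_def
proof (intro allI impI)
  fix \<Gamma> assume ind: "induced_subgraph \<Gamma> (with_proj (enhanced_power_graph G))"
  let ?P = "enhanced_power_graph G"
  \<comment> \<open>Compatibility with the ambient graph forces the two projections, so adjacency in
    \<open>\<Gamma>\<close> is membership of a pair in \<open>parcs ?P\<close>.\<close>
  have sub: "verts \<Gamma> \<subseteq> carrier G" and proj: "tail \<Gamma> = fst" "head \<Gamma> = snd"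
    and arcs: "arcs \<Gamma> = {e \<in> parcs ?P. fst e \<in> verts \<Gamma> \<and> snd e \<in> verts \<Gamma>}"
    using ind unfolding induced_subgraph_def subgraph_def compatible_def with_proj_simps
    by (simp_all add: enhanced_power_graph_def)
  have adj: "u \<rightarrow>\<^bsub>\<Gamma>\<^esub> v \<longleftrightarrow> (u, v) \<in> parcs ?P \<and> u \<in> verts \<Gamma> \<and> v \<in> verts \<Gamma>" for u v
    by (auto simp: arcs_ends_def arc_to_ends_def proj arcs image_iff)
  have adjP: "(u, v) \<in> parcs ?P \<longleftrightarrow> u \<in> carrier G \<and> v \<in> carrier G \<and> u \<noteq> v
      \<and> (u \<in> range (\<lambda>k::int. a [^] k) \<and> v \<in> range (\<lambda>k::int. a [^] k) \<or> u = \<one> \<or> v = \<one>)" for u v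
    by (rule enhanced_power_graph_adj[OF a]) (rule invol)
  show "clique_number \<Gamma> = chromatic_number \<Gamma>"
  proof (rule clique_number_eq_chromatic_number_pendants)
    show "finite (verts \<Gamma>)" using sub fin by (rule finite_subset)
    show "\<one> \<in> range (\<lambda>k::int. a [^] k)" by (rule range_eqI[of _ _ 0]) simp
    show "u \<rightarrow>\<^bsub>\<Gamma>\<^esub> v \<longleftrightarrow> u \<in> verts \<Gamma> \<and> v \<in> verts \<Gamma> \<and> u \<noteq> v
        \<and> (u \<in> range (\<lambda>k::int. a [^] k) \<and> v \<in> range (\<lambda>k::int. a [^] k) \<or> u = \<one> \<or> v = \<one>)" for u v
      using subsetD[OF sub, of u] subsetD[OF sub, of v] adjP[of u v] unfolding adj by argo
  qed
qed

text \<open>The relation \<open>ab = ba'\<close>, with \<open>a'\<close> the inverse letter of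
  \<open>a\<close>, gives \<open>aba = b\<close>. Peeling off one \<open>a\<close> on each side
  yields \<open>a^i b a^i = b\<close>, and appending \<open>b\<close> reduces the square of
  \<open>a^i b\<close> to \<open>bb\<close>.\<close>

lemma dihedral_rels_reflection_square:
  fixes i :: nat
  defines "w \<equiv> replicate i (Rot, False) @ [(Ref, False)]"
  shows "pres_eq (dihedral_rels n) (w @ w) []"
proof -
  define a where "a = (Rot, False)"
  define b where "b = (Ref, False)"
  define E where "E = pres_eq (dihedral_rels n)"
  note [trans] = pres_eq.trans[of "dihedral_rels n", folded E_def]
  have ctxt: "E v w \<Longrightarrow> E (p @ v @ q) (p @ w @ q)" for v w p q
    unfolding E_def by (rule pres_eq_ctxt)
  have bb: "E [b, b] []" and ab: "E [a, b] [b, (Rot, True)]"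
    using pres_eq.rel[of _ _ "dihedral_rels n" "[]" "[]"]
    by (auto simp: E_def dihedral_rels_def Let_def a_def b_def)
  have "E [a, b, a] [b, (Rot, True), a]" using ctxt[OF ab, of "[]" "[a]"] by simp
  also have "E [b, (Rot, True), a] [b]"
    using pres_eq.cancel[of "dihedral_rels n" "[b]" Rot True "[]"] by (simp add: E_def a_def)
  finally have aba: "E [a, b, a] [b]" .
  have conj: "E (replicate k a @ b # replicate k a) [b]" for k
  proof (induction k)
    case 0
    show ?case by (simp add: E_def pres_eq.refl)
  next
    case (Suc k)
    \<comment> \<open>The innermost \<open>a\<close> on each side is grouped with \<open>b\<close>,
      so that \<open>aba\<close> applies in the middle.\<close>
    have "replicate (Suc k) a @ b # replicate (Suc k) a
        = replicate k a @ [a, b, a] @ replicate k a"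
      by (simp add: replicate_app_Cons_same)
    also have "E \<dots> (replicate k a @ [b] @ replicate k a)" using aba by (rule ctxt)
    also have "E \<dots> [b]" using Suc.IH by simp
    finally show ?case .
  qed
  have "E ((replicate i a @ b # replicate i a) @ [b]) [b, b]"
    using ctxt[OF conj, of "[]" i "[b]"] by simp
  also note bb
  finally show ?thesis by (simp add: E_def w_def a_def b_def)
qed

text \<open>This recognises the reflection-free normal forms as powers of the rotation.\<close>

lemma presented_group_pow:
  "pres_class R [x] [^]\<^bsub>presented_group R\<^esub> (k::nat) = pres_class R (replicate k x)"
proof (induction k)
  case 0
  show ?case by (simp add: presented_group_def)
next
  case (Suc k)
  then show ?case
    by (simp add: pres_class_mult replicate_append_same flip: replicate_Suc)
qed

theorem theorem3p31:
  fixes n :: nat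
  assumes "n \<ge> 3"
  shows "perfect_graph (with_proj (enhanced_power_graph (dihedral_group n)))"
proof -
  let ?G = "dihedral_group n"
  let ?cl = "pres_class (dihedral_rels n)"
  let ?a = "?cl [(Rot, False)]"
  interpret group ?G by (rule group_dihedral_group)
  have carr: "carrier ?G = range ?cl"
    and one: "\<one>\<^bsub>presented_group (dihedral_rels n)\<^esub> = ?cl []"
    by (simp_all add: dihedral_group_def presented_group_def)
  show ?thesis
  proof (rule perfect_enhanced_power_graph)
    \<comment> \<open>An infinite carrier would have \<open>card\<close> 0, whereas the order
      \<open>2 * n\<close> is positive.\<close>
    show "finite (carrier ?G)"
      using order_dihedral_group[OF assms] assms by (auto simp: order_def intro: card_ge_0_finite)
    show "?a \<in> carrier ?G" by (simp add: carr)
    fix x assume "x \<in> carrier ?G" and x: "x \<notin> range (\<lambda>k::int. ?a [^]\<^bsub>?G\<^esub> k)"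
    then obtain u where u: "x = ?cl u" by (auto simp: carr)
    obtain i j where "j < 2" and nf: "x = ?cl (dihedral_nf (i, j))"
      using dihedral_word_nf[of n u] assms by (auto simp: u pres_class_eq_iff)
    \<comment> \<open>Without the letter \<open>Ref\<close> the normal form would be a power of
      \<open>?a\<close>, so \<open>x\<close> is a reflection \<open>a^i b\<close>.\<close>
    have "j \<noteq> 0"
    proof
      assume "j = 0"
      then have "x = ?a [^]\<^bsub>?G\<^esub> i"
        unfolding dihedral_group_def presented_group_pow by (simp add: nf dihedral_nf_def)
      then have "x = ?a [^]\<^bsub>?G\<^esub> int i" by (simp add: int_pow_int)
      with x show False by blast
    qed
    with \<open>j < 2\<close> have "j = 1" by simp
    then show "x \<otimes>\<^bsub>?G\<^esub> x = \<one>\<^bsub>?G\<^esub>"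
      using dihedral_rels_reflection_square[of n i]
      unfolding one nf dihedral_group_def pres_class_mult pres_class_eq_iff
      by (simp add: dihedral_nf_def)
  qed
qed

end
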